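(* Let $\rho>1$, let $u\in\mathcal A_\rho$, put $M=\max_{z\in\mathcal E_\rho}|u(z)|$, and let $\{\hat u_n^{0,0}\}$ be the Legendre expansion coefficients of $u$. Then for every integer $n\ge1$, $$ \big|\hat u_n^{0,0}\big|\le\frac{M\sqrt{\pi n}}{\rho^{n}}\Big(1+\frac{n+2}{2n+3}\,\frac{1}{\rho^2-1}\Big)\exp\Big(\frac{8n-1}{12n(2n-1)}\Big). $$
   Context: For $\rho>1$, the Bernstein ellipse is $\mathcal E_\rho=\{z\in\mathbb C: z=\tfrac12(w+w^{-1}),\ w=\rho e^{\mathrm i\theta},\ \theta\in[0,2\pi]\}$, and $\mathcal A_\rho$ is the set of functions analytic on and within $\mathcal E_\rho$. The Legendre expansion coefficients of $u$ are $\hat u_n^{0,0}=\frac{2n+1}{2}\int_{-1}^1u(x)L_n(x)\,dx$, where $L_n=J_n^{0,0}$ is the Legendre polynomial of degree $n$ in the standard normalization ($L_n(1)=1$, $\int_{-1}^1L_n^2\,dx=\frac{2}{2n+1}$). *)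

theory Defs
  imports "HOL-Analysis.Analysis" "HOL-Computational_Algebra.Polynomial"
begin

definition bernstein_ellipse :: "real \<Rightarrow> complex set" where
  "bernstein_ellipse \<rho> =
     {z. \<exists>\<theta>\<in>{0..2 * pi}. \<exists>w. w = of_real \<rho> * exp (\<i> * of_real \<theta>) \<and> z = (w + inverse w) / 2}"

text \<open>\<open>inside\<close> is the union of the bounded components of the complement, so this is analyticity in
  a neighbourhood of the closed region bounded by the ellipse.\<close>

definition bernstein_analytic :: "real \<Rightarrow> (complex \<Rightarrow> complex) set" where
  "bernstein_analytic \<rho> =
     {u. u analytic_on (bernstein_ellipse \<rho> \<union> inside (bernstein_ellipse \<rho>))}"

text \<open>Rodrigues' formula.\<close>

definition legendre_poly :: "nat \<Rightarrow> real poly" where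
  "legendre_poly n = smult (1 / (2 ^ n * fact n)) ((pderiv ^^ n) ([:-1, 0, 1:] ^ n))"

definition legendre_coeff :: "(complex \<Rightarrow> complex) \<Rightarrow> nat \<Rightarrow> complex" where
  "legendre_coeff u n =
     (2 * of_nat n + 1) / 2 *
       integral {-1..1} (\<lambda>x::real. u (of_real x) * of_real (poly (legendre_poly n) x))"

lemma degree_legendre_poly: "degree (legendre_poly n) = n"
  by (simp add: legendre_poly_def degree_higher_pderiv degree_power_eq)

lemma legendre_poly_at_1: "poly (legendre_poly n) 1 = 1"
proof -
  have shift: "(([:-1, 0, 1:] :: real poly) ^ n) \<circ>\<^sub>p [:1, 1:] = monom 1 n * [:2, 1:] ^ n"
  proof -
    have "([:-1, 0, 1:] :: real poly) \<circ>\<^sub>p [:1, 1:] = [:0, 1:] * [:2, 1:]"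
      by (simp add: pcompose_pCons)
    moreover have "(p ^ k) \<circ>\<^sub>p q = (p \<circ>\<^sub>p q) ^ k" for p q :: "real poly" and k
      by (induction k) (simp_all add: pcompose_mult pcompose_1)
    ultimately show ?thesis
      by (simp only: power_mult_distrib monom_altdef smult_1_left)
  qed
  have comp: "(pderiv ^^ k) (p \<circ>\<^sub>p [:1, 1:]) = ((pderiv ^^ k) p) \<circ>\<^sub>p [:1, 1:]"
    for k and p :: "real poly"
    by (induction k) (simp_all add: pderiv_pcompose pderiv_pCons)
  have "poly ((pderiv ^^ n) ([:-1, 0, 1:] ^ n)) (1::real)
      = poly ((pderiv ^^ n) (([:-1, 0, 1:] ^ n) \<circ>\<^sub>p [:1, 1:])) 0"
    by (simp add: comp poly_pcompose)
  also have "\<dots> = fact n * 2 ^ n"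
    unfolding shift poly_0_coeff_0 coeff_higher_pderiv
    by (simp add: coeff_monom_mult pochhammer_fact coeff_0_power)
  finally show ?thesis
    by (simp add: legendre_poly_def)
qed

text \<open>The supremum of \<open>\<bar>u\<bar>\<close> over the ellipse is a maximum.\<close>

lemma SUP_bernstein_ellipse_attained:
  assumes "\<rho> > 1" "u \<in> bernstein_analytic \<rho>"
  shows "\<exists>z\<in>bernstein_ellipse \<rho>. norm (u z) = (SUP z\<in>bernstein_ellipse \<rho>. norm (u z)) \<and>
           (\<forall>z'\<in>bernstein_ellipse \<rho>. norm (u z') \<le> norm (u z))"
proof -
  define g where "g = (\<lambda>\<theta>::real. (of_real \<rho> * exp (\<i> * of_real \<theta>) +
                            inverse (of_real \<rho> * exp (\<i> * of_real \<theta>))) / (2::complex))"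
  have E: "bernstein_ellipse \<rho> = g ` {0..2 * pi}"
    by (auto simp: bernstein_ellipse_def g_def)
  have "continuous_on {0..2 * pi} g"
    unfolding g_def using assms(1) by (intro continuous_intros) auto
  hence cpt: "compact (bernstein_ellipse \<rho>)"
    unfolding E by (rule compact_continuous_image) simp
  have "u analytic_on bernstein_ellipse \<rho>"
    using assms(2) by (auto simp: bernstein_analytic_def intro: analytic_on_subset)
  hence "continuous_on (bernstein_ellipse \<rho>) (\<lambda>z. norm (u z))"
    by (intro continuous_intros holomorphic_on_imp_continuous_on analytic_imp_holomorphic)
  moreover have "bernstein_ellipse \<rho> \<noteq> {}" by (simp add: E)
  ultimately obtain z where z: "z \<in> bernstein_ellipse \<rho>"
      "\<forall>z'\<in>bernstein_ellipse \<rho>. norm (u z') \<le> norm (u z)"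
    using continuous_attains_sup[OF cpt] by blast
  have "(SUP z\<in>bernstein_ellipse \<rho>. norm (u z)) = norm (u z)"
    by (rule cSup_eq_maximum) (use z in auto)
  thus ?thesis using z by metis
qed

end

theory Submission
  imports Defs "HOL-Complex_Analysis.Complex_Analysis"
begin

text \<open>Parametrise the ellipse by \<open>z = (w + 1/w)/2\<close>, \<open>|w| = \<rho>\<close>. In this parametrisation the Cauchy
  kernel \<open>dz/(z - x)\<close> is \<open>(1 + \<Sum>k\<ge>1. 2 T\<^sub>k(x) w\<^sup>-\<^sup>k) dw/w\<close>, so Cauchy's formula gives the Chebyshev
  expansion of \<open>u\<close> on \<open>[-1,1]\<close> with coefficients of modulus at most \<open>M/\<rho>\<^sup>k\<close> for
  \<open>1, 2 T\<^sub>1, 2 T\<^sub>2, \<dots>\<close>. It remains to know the Legendre coefficients of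
  \<open>2 T\<^sub>k = U\<^sub>k - U\<^sub>k\<^sub>-\<^sub>2\<close>. Those of \<open>U\<^sub>k\<close> satisfy a two-step recurrence in \<open>k\<close>, a
  consequence of the two differential equations: they vanish unless \<open>k = n + 2 j\<close>, and are then positive
  and decreasing in \<open>j\<close>, starting from \<open>4\<^sup>n (n!)\<^sup>2 / (2 n)!\<close>, which is estimated by Wallis' product.
  The difference of consecutive ones is at most \<open>(n + 2)/(2 n + 3)\<close> times the first, and summing
  the geometric series in \<open>1/\<rho>\<^sup>2\<close> gives the bound.\<close>

subsection \<open>Legendre coefficients of the Chebyshev polynomials\<close>

definition poly_integral :: "real poly \<Rightarrow> real" where
  "poly_integral p = integral {-1..1} (poly p)"

lemma poly_integrable [simp]: "poly p integrable_on {a..b}" for p :: "real poly"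
  by (intro integrable_continuous_real continuous_intros)

lemma poly_integral_add: "poly_integral (p + q) = poly_integral p + poly_integral q"
proof -
  have "poly (p + q) = (\<lambda>x. poly p x + poly q x)" by auto
  then show ?thesis unfolding poly_integral_def by (simp add: integral_add)
qed

lemma poly_integral_smult: "poly_integral (smult c p) = c * poly_integral p"
proof -
  have "poly (smult c p) = (\<lambda>x. c * poly p x)" by auto
  then show ?thesis unfolding poly_integral_def by simp
qed

lemma poly_integral_minus: "poly_integral (- p) = - poly_integral p"
  using poly_integral_smult[of "-1" p] by simp

lemma poly_integral_diff: "poly_integral (p - q) = poly_integral p - poly_integral q"
  using poly_integral_add[of p "- q"] by (simp add: poly_integral_minus)

lemma poly_integral_0 [simp]: "poly_integral 0 = 0"
  using poly_integral_smult[of 0 0] by simp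

lemma poly_integral_pderiv: "poly_integral (pderiv p) = poly p 1 - poly p (-1)"
proof -
  have "(poly (pderiv p) has_integral (poly p 1 - poly p (-1))) {-1..1}"
    by (rule fundamental_theorem_of_calculus)
       (auto simp flip: has_real_derivative_iff_has_vector_derivative
             intro: DERIV_subset[OF poly_DERIV])
  then show ?thesis by (simp add: poly_integral_def integral_unique)
qed

lemma poly_integral_by_parts:
  assumes "poly (p * q) 1 = 0" "poly (p * q) (-1) = 0"
  shows "poly_integral (pderiv p * q) = - poly_integral (p * pderiv q)"
proof -
  have "poly_integral (pderiv (p * q)) = 0"
    unfolding poly_integral_pderiv assms by simp
  then show ?thesis
    by (simp add: pderiv_mult poly_integral_add mult.commute)
qed

section \<open>Chebyshev polynomials of the second kind: derivative identities and differential
  equation\<close>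

fun cheb_U :: "nat \<Rightarrow> real poly" where
  "cheb_U 0 = 1"
| "cheb_U (Suc 0) = [:0, 2:]"
| "cheb_U (Suc (Suc m)) = [:0, 2:] * cheb_U (Suc m) - cheb_U m"

text \<open>One induction serves both identities: the step for the first needs the second, and the
  step for the second needs both.\<close>

lemma pderiv_cheb_U:
  shows "pderiv (cheb_U (Suc m)) - [:0, 1:] * pderiv (cheb_U m) = smult (real m + 2) (cheb_U m)"
    and "[:0, 1:] * pderiv (cheb_U (Suc m)) - pderiv (cheb_U m)
           = smult (real m + 1) (cheb_U (Suc m))"
proof -
  have "poly (pderiv (cheb_U (Suc m))) x - x * poly (pderiv (cheb_U m)) x
          = (real m + 2) * poly (cheb_U m) x \<and>
        x * poly (pderiv (cheb_U (Suc m))) x - poly (pderiv (cheb_U m)) x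
          = (real m + 1) * poly (cheb_U (Suc m)) x" for x
  proof (induction m)
    case (Suc m)
    have [simp]: "poly (cheb_U (Suc (Suc m))) x
        = 2 * x * poly (cheb_U (Suc m)) x - poly (cheb_U m) x"
      by simp
    have [simp]: "poly (pderiv (cheb_U (Suc (Suc m)))) x
        = 2 * poly (cheb_U (Suc m)) x + 2 * x * poly (pderiv (cheb_U (Suc m))) x
          - poly (pderiv (cheb_U m)) x"
      by (simp add: pderiv_mult pderiv_diff pderiv_smult pderiv_pCons algebra_simps)
    show ?case using Suc by (simp del: cheb_U.simps) algebra
  qed (simp_all add: pderiv_pCons)
  then show "pderiv (cheb_U (Suc m)) - [:0, 1:] * pderiv (cheb_U m) = smult (real m + 2) (cheb_U m)"
    and "[:0, 1:] * pderiv (cheb_U (Suc m)) - pderiv (cheb_U m)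
           = smult (real m + 1) (cheb_U (Suc m))"
    by (simp_all add: poly_eq_poly_eq_iff[symmetric] fun_eq_iff)
qed

text \<open>This is \<open>(1 - x^2) U'' - 3 x U' + m (m + 2) U = 0\<close>, arranged so that the
  left side is the self-adjoint operator of the Legendre equation. The first-order term on the right
  is what remains when the two equations are compared.\<close>

lemma cheb_U_ode:
  "pderiv ([:1, 0, -1:] * pderiv (cheb_U m))
     = [:0, 1:] * pderiv (cheb_U m) - smult (real m * (real m + 2)) (cheb_U m)"
proof (cases m)
  case 0
  then show ?thesis by simp
next
  case (Suc k)
  \<comment> \<open>Eliminating the derivative of \<open>cheb_U k\<close> between the two identities
    gives a first-order relation, which is then differentiated.\<close>
  have "[:1, 0, -1:] * pderiv (cheb_U m)
          = smult (real m + 1) (cheb_U k) - smult (real m) ([:0, 1:] * cheb_U m)"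
  proof (rule poly_ext)
    fix x :: real
    show "poly ([:1, 0, -1:] * pderiv (cheb_U m)) x
      = poly (smult (real m + 1) (cheb_U k) - smult (real m) ([:0, 1:] * cheb_U m)) x"
      using arg_cong[OF pderiv_cheb_U(1)[of k], of "\<lambda>p. poly p x"]
        arg_cong[OF pderiv_cheb_U(2)[of k], of "\<lambda>p. poly p x"] unfolding Suc
      by (simp del: cheb_U.simps) algebra
  qed
  from arg_cong[OF this, of pderiv] have "pderiv ([:1, 0, -1:] * pderiv (cheb_U m))
      = smult (real m + 1) (pderiv (cheb_U k))
        - smult (real m) (cheb_U m + [:0, 1:] * pderiv (cheb_U m))"
    unfolding pderiv_diff pderiv_smult pderiv_mult[of "[:0, 1:]"]
    by (simp add: pderiv_pCons add.commute)
  also have "\<dots> = [:0, 1:] * pderiv (cheb_U m) - smult (real m * (real m + 2)) (cheb_U m)"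
  proof (rule poly_ext)
    fix x :: real
    show "poly (smult (real m + 1) (pderiv (cheb_U k))
        - smult (real m) (cheb_U m + [:0, 1:] * pderiv (cheb_U m))) x
      = poly ([:0, 1:] * pderiv (cheb_U m) - smult (real m * (real m + 2)) (cheb_U m)) x"
      using arg_cong[OF pderiv_cheb_U(2)[of k], of "\<lambda>p. poly p x"] unfolding Suc
      by (simp del: cheb_U.simps) algebra
  qed
  finally show ?thesis .
qed

section \<open>Legendre polynomials: differential equation and integration by parts in Rodrigues'
  formula\<close>

lemma legendre_ode:
  "pderiv ([:1, 0, -1:] * pderiv (legendre_poly n))
     = - smult (real n * (real n + 1)) (legendre_poly n)"
proof -
  define v :: "real poly" where "v = [:-1, 0, 1:] ^ n"
  define D where "D k = (pderiv ^^ k) v" for k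
  have D_Suc: "pderiv (D k) = D (Suc k)" for k
    by (simp add: D_def)
  \<comment> \<open>From \<open>v = (x^2 - 1)^n\<close> follows
    \<open>(x^2 - 1) v' = 2 n x v\<close>; this is that relation differentiated \<open>k + 1\<close>
    times. At \<open>k = n\<close> it is the Legendre equation for \<open>D n\<close>.\<close>
  have *: "[:-1, 0, 1:] * D (k + 2) + smult (2 * (real k + 1) - 2 * real n) ([:0, 1:] * D (k + 1))
        + smult ((real k + 1) * real k - 2 * real n * (real k + 1)) (D k) = 0" for k
  proof (induction k)
    case 0
    have "[:-1, 0, 1:] * pderiv v = smult (2 * real n) ([:0, 1:] * v)"
    proof (cases n)
      case (Suc m)
      then show ?thesis
        unfolding v_def Suc pderiv_power_Suc by (simp add: pderiv_pCons algebra_simps)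
    qed (simp add: v_def)
    then have "pderiv ([:-1, 0, 1:] * pderiv v) = pderiv (smult (2 * real n) ([:0, 1:] * v))"
      by simp
    then show ?case
      by (simp add: D_def eval_nat_numeral pderiv_mult pderiv_smult pderiv_pCons pderiv_diff
          
           poly_eq_poly_eq_iff[symmetric] fun_eq_iff algebra_simps)
  next
    case (Suc k)
    have "pderiv ([:-1, 0, 1:] * D (k + 2)
        + smult (2 * (real k + 1) - 2 * real n) ([:0, 1:] * D (k + 1))
        + smult ((real k + 1) * real k - 2 * real n * (real k + 1)) (D k)) = 0"
      unfolding Suc by simp
    then show ?case
      by (simp add: D_Suc pderiv_add pderiv_diff pderiv_mult pderiv_smult pderiv_pCons
           poly_eq_poly_eq_iff[symmetric] fun_eq_iff algebra_simps)
  qed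
  define c :: real where "c = 1 / (2 ^ n * fact n)"
  have L: "legendre_poly n = smult c (D n)" 
    by (simp add: legendre_poly_def D_def v_def c_def)
  have "pderiv ([:1, 0, -1:] * pderiv (D n)) = - smult (real n * (real n + 1)) (D n)"
    using *[of n]
    by (simp add: D_Suc pderiv_mult pderiv_add pderiv_minus pderiv_pCons
           poly_eq_poly_eq_iff[symmetric] fun_eq_iff algebra_simps)
  then show ?thesis
    unfolding L pderiv_smult mult_smult_right by (simp add: mult_ac)
qed

text \<open>Each differentiation costs at most one factor of \<open>p\<close>. For
  \<open>p = x^2 - 1\<close> the derivatives of order below \<open>n\<close> therefore vanish at
  both endpoints, which removes the boundary terms from integration by parts.\<close>

lemma pderiv_power_dvd:
  fixes p :: "real poly"
  assumes "j \<le> n"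
  shows "p ^ (n - j) dvd (pderiv ^^ j) (p ^ n)"
  using assms
proof (induction j)
  case (Suc j)
  then obtain q where q: "(pderiv ^^ j) (p ^ n) = p ^ (n - j) * q"
    by (auto elim: dvdE)
  obtain k where k: "n - j = Suc k" "n - Suc j = k"
    using Suc.prems by (metis Suc_diff_Suc Suc_le_lessD)
  show ?case
    unfolding k funpow.simps o_apply q[unfolded k] pderiv_mult pderiv_power_Suc
    by (intro dvd_add dvd_mult2 dvd_mult dvd_smult) simp_all
qed simp

text \<open>Integrating by parts \<open>n\<close> times moves every derivative in Rodrigues' formula
  onto \<open>f\<close>; the accumulated sign turns \<open>(x^2 - 1)^n\<close> into
  \<open>(1 - x^2)^n\<close>.\<close>

lemma poly_integral_legendre_eq:
  "poly_integral (legendre_poly n * f)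
     = poly_integral ([:1, 0, -1:] ^ n * (pderiv ^^ n) f) / (2 ^ n * fact n)"
proof -
  define v :: "real poly" where "v = [:-1, 0, 1:] ^ n"
  have *: "poly_integral ((pderiv ^^ n) v * f)
      = (-1) ^ k * poly_integral ((pderiv ^^ (n - k)) v * (pderiv ^^ k) f)" if "k \<le> n" for k
    using that
  proof (induction k)
    case (Suc k)
    define j where "j = n - Suc k"
    have j: "n - k = Suc j" "j < n" using Suc.prems by (auto simp: j_def)
    obtain q where q: "(pderiv ^^ j) v = [:-1, 0, 1:] ^ (n - j) * q"
      unfolding v_def using pderiv_power_dvd[of j n "[:-1, 0, 1:]"] j by (auto elim: dvdE)
    have "poly_integral ((pderiv ^^ Suc j) v * (pderiv ^^ k) f)
        = - poly_integral ((pderiv ^^ j) v * pderiv ((pderiv ^^ k) f))"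
      unfolding funpow.simps o_apply
      by (rule poly_integral_by_parts) (use q j in \<open>auto simp: power_0_left\<close>)
    then show ?case using Suc j by (simp add: j_def[symmetric])
  qed simp
  have "(-1) ^ n * poly_integral (v * (pderiv ^^ n) f)
     = poly_integral (smult ((-1) ^ n) (v * (pderiv ^^ n) f))"
    by (simp add: poly_integral_smult)
  also have "smult ((-1) ^ n) (v * (pderiv ^^ n) f) = [:1, 0, -1:] ^ n * (pderiv ^^ n) f"
    unfolding v_def mult_smult_left[symmetric] smult_power[symmetric] by simp
  finally show ?thesis
    using *[of n] by (simp add: legendre_poly_def v_def poly_integral_smult mult_ac)
qed

lemma poly_integral_one_minus_sq_power:
  "poly_integral ([:1, 0, -1:] ^ n) = 2 * 4 ^ n * (fact n)\<^sup>2 / fact (2 * n + 1)"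
proof (induction n)
  case 0
  have "poly_integral 1 = poly_integral (pderiv [:0, 1:])" by (simp add: pderiv_pCons one_pCons)
  also have "\<dots> = 2" unfolding poly_integral_pderiv by simp
  finally show ?case by simp
next
  case (Suc n)
  define p :: "real poly" where "p = [:1, 0, -1:]"
  \<comment> \<open>The polynomial \<open>x (1 - x^2)^(n + 1)\<close> vanishes at both endpoints, so
    integrating its derivative links the integrals for \<open>n + 1\<close> and
    \<open>n\<close>.\<close>
  have "pderiv ([:0, 1:] * p ^ Suc n) = smult (2 * n + 3) (p ^ Suc n) - smult (2 * n + 2) (p ^ n)"
    unfolding pderiv_mult pderiv_power_Suc
    by (rule poly_ext) (simp add: p_def pderiv_pCons algebra_simps power2_eq_square)
  then have "(2 * n + 3) * poly_integral (p ^ Suc n) - (2 * n + 2) * poly_integral (p ^ n)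
      = poly_integral (pderiv ([:0, 1:] * p ^ Suc n))"
    by (simp only: poly_integral_diff poly_integral_smult)
  also have "\<dots> = 0"
    unfolding poly_integral_pderiv by (simp add: p_def)
  finally have "poly_integral (p ^ Suc n) = (2 * n + 2) / (2 * n + 3) * poly_integral (p ^ n)"
    by (simp add: field_simps)
  also have "\<dots> = 2 * 4 ^ Suc n * (fact (Suc n))\<^sup>2 / fact (2 * Suc n + 1)"
    unfolding p_def Suc.IH
    by (simp add: divide_simps power2_eq_square del: of_nat_Suc) (simp add: algebra_simps)
  finally show ?case by (simp add: p_def)
qed

lemma degree_coeff_cheb_U: "degree (cheb_U m) \<le> m \<and> coeff (cheb_U m) m = 2 ^ m"
proof (induction m rule: cheb_U.induct)
  case (3 m)
  have "degree ([:0, 2:] * cheb_U (Suc m)) \<le> Suc (Suc m)"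
    using 3 by (intro order.trans[OF degree_mult_le]) auto
  then have "degree (cheb_U (Suc (Suc m))) \<le> Suc (Suc m)"
    using 3 unfolding cheb_U.simps by (intro degree_diff_le) auto
  moreover have "coeff (cheb_U m) (Suc (Suc m)) = 0"
    using 3 by (intro coeff_eq_0) auto
  ultimately show ?case using 3 by simp
qed simp_all

section \<open>Legendre coefficients of the Chebyshev polynomials of the second kind\<close>

definition legendre_coeff_U :: "nat \<Rightarrow> nat \<Rightarrow> real" where
  "legendre_coeff_U n m = (2 * real n + 1) / 2 * poly_integral (legendre_poly n * cheb_U m)"

text \<open>The \<open>n\<close>-th derivative of \<open>cheb_U n\<close> is the constant
  \<open>2^n n!\<close>, which cancels the normalisation in Rodrigues' formula and leaves the
  integral of \<open>(1 - x^2)^n\<close>.\<close>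

lemma legendre_coeff_U_diag: "legendre_coeff_U n n = 4 ^ n * (fact n)\<^sup>2 / fact (2 * n)"
proof -
  have "(pderiv ^^ n) (cheb_U n) = [:2 ^ n * fact n:]"
  proof (rule poly_eqI)
    fix i
    show "coeff ((pderiv ^^ n) (cheb_U n)) i = coeff [:2 ^ n * fact n:] i"
      using degree_coeff_cheb_U[of n]
      by (cases i) (auto simp: coeff_higher_pderiv pochhammer_fact intro!: coeff_eq_0)
  qed
  then have "poly_integral (legendre_poly n * cheb_U n)
      = poly_integral (smult (2 ^ n * fact n) ([:1, 0, -1:] ^ n)) / (2 ^ n * fact n)"
    unfolding poly_integral_legendre_eq by simp
  also have "\<dots> = 2 * 4 ^ n * (fact n)\<^sup>2 / fact (2 * n + 1)"
    unfolding poly_integral_smult poly_integral_one_minus_sq_power by simp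
  finally have "legendre_coeff_U n n = (2 * real n + 1) / 2 * (2 * 4 ^ n * (fact n)\<^sup>2 / fact (2 * n + 1))"
    unfolding legendre_coeff_U_def by simp
  moreover have "fact (2 * n + 1) = (2 * real n + 1) * fact (2 * n)"
    by simp
  moreover have "2 * real n + 1 \<noteq> 0"
    by linarith
  ultimately show ?thesis
    by (simp add: add.commute)
qed

text \<open>Lagrange's identity for the two differential equations: the boundary term carries the
  factor \<open>1 - x^2\<close> and vanishes.\<close>

lemma legendre_coeff_U_pderiv:
  "(real m * (real m + 2) - real n * (real n + 1)) * poly_integral (legendre_poly n * cheb_U m)
     = poly_integral (legendre_poly n * ([:0, 1:] * pderiv (cheb_U m)))"
proof -
  define L where "L = legendre_poly n"
  define U where "U = cheb_U m"
  define p :: "real poly" where "p = [:1, 0, -1:]"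
  have "pderiv (p * (L * pderiv U - pderiv L * U))
      = L * pderiv (p * pderiv U) - pderiv (p * pderiv L) * U"
    by (simp add: pderiv_mult pderiv_diff algebra_simps)
  also have "\<dots> = L * ([:0, 1:] * pderiv U) - smult (real m * (real m + 2) - real n * (real n + 1)) (L * U)"
    unfolding p_def L_def U_def legendre_ode cheb_U_ode
    by (rule poly_ext) (simp add: algebra_simps)
  finally have "poly_integral (L * ([:0, 1:] * pderiv U))
      - (real m * (real m + 2) - real n * (real n + 1)) * poly_integral (L * U)
      = poly_integral (pderiv (p * (L * pderiv U - pderiv L * U)))"
    by (simp only: poly_integral_diff poly_integral_smult)
  also have "\<dots> = 0" unfolding poly_integral_pderiv by (simp add: p_def)
  finally show ?thesis by (simp add: L_def U_def)
qed

lemma legendre_coeff_U_0_eq_0: "n \<ge> 1 \<Longrightarrow> legendre_coeff_U n 0 = 0"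
  using legendre_coeff_U_pderiv[of 0 n] by (simp add: legendre_coeff_U_def)

text \<open>The polynomial \<open>2 x\<close> satisfies \<open>x U' = U\<close>, so the relation
  from Lagrange's identity reduces to a factor \<open>2 - n (n + 1)\<close>, which is zero only for
  \<open>n = 1\<close>.\<close>

lemma legendre_coeff_U_1_eq_0: "n \<noteq> 1 \<Longrightarrow> legendre_coeff_U n (Suc 0) = 0"
proof -
  assume n: "n \<noteq> 1"
  have "(3 - real n * (real n + 1)) * poly_integral (legendre_poly n * cheb_U (Suc 0))
      = poly_integral (legendre_poly n * cheb_U (Suc 0))"
    using legendre_coeff_U_pderiv[of 1 n] by (simp add: pderiv_pCons)
  then have "(2 - real n * (real n + 1)) * legendre_coeff_U n (Suc 0) = 0"
    by (simp add: legendre_coeff_U_def algebra_simps)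
  moreover have "real n * (real n + 1) = real (n * (n + 1))" by (simp add: algebra_simps)
  moreover have "n * (n + 1) \<noteq> 2"
    using n by (cases n; cases "n - 1") auto
  ultimately show ?thesis by (metis divisors_zero right_minus_eq of_nat_eq_iff of_nat_numeral)
qed

text \<open>Both sides equal the integral of the Legendre polynomial against the derivative of
  \<open>cheb_U (Suc m)\<close>, up to a common factor.\<close>

lemma legendre_coeff_U_recurrence:
  "((real m + 2) * (real m + 3) - real n * (real n + 1)) * legendre_coeff_U n (Suc (Suc m))
     = ((real m + 1) * (real m + 2) - real n * (real n + 1)) * legendre_coeff_U n m"
proof -
  let ?I = "\<lambda>q. poly_integral (legendre_poly n * q)"
  have lin: "?I (p - q) = ?I p - ?I q" "?I (smult c p) = c * ?I p" for p q c
    by (simp_all add: right_diff_distrib poly_integral_diff poly_integral_smult)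
  have "?I (pderiv (cheb_U (Suc m))) - ?I ([:0, 1:] * pderiv (cheb_U m)) = (real m + 2) * ?I (cheb_U m)"
    using arg_cong[OF pderiv_cheb_U(1)[of m], of ?I] unfolding lin .
  moreover have "?I ([:0, 1:] * pderiv (cheb_U (Suc (Suc m)))) - ?I (pderiv (cheb_U (Suc m)))
      = (real (Suc m) + 1) * ?I (cheb_U (Suc (Suc m)))"
    using arg_cong[OF pderiv_cheb_U(2)[of "Suc m"], of ?I] unfolding lin .
  ultimately show ?thesis
    unfolding legendre_coeff_U_pderiv[symmetric] legendre_coeff_U_def
    by (simp del: cheb_U.simps) algebra
qed

text \<open>Two-step induction along the recurrence. The factor in front of the new coefficient is
  \<open>(m + 2 - n) (m + 3 + n)\<close>, zero only when \<open>m + 2 = n\<close>, which is the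
  excluded case \<open>j = 0\<close>.\<close>

lemma legendre_coeff_U_eq_0:
  assumes "n \<ge> 1" "\<And>j. m \<noteq> n + 2 * j"
  shows "legendre_coeff_U n m = 0"
  using assms(2)
proof (induction m rule: cheb_U.induct)
  case 1
  then show ?case using assms(1) by (simp add: legendre_coeff_U_0_eq_0)
next
  case 2
  then show ?case using 2[of 0] by (intro legendre_coeff_U_1_eq_0) auto
next
  case (3 m)
  have "m \<noteq> n + 2 * j" for j using "3.prems"[of "Suc j"] by simp
  then have "legendre_coeff_U n m = 0" by (rule 3)
  then have "((real m + 2) * (real m + 3) - real n * (real n + 1)) * legendre_coeff_U n (Suc (Suc m)) = 0"
    unfolding legendre_coeff_U_recurrence by simp
  moreover have "(real m + 2) * (real m + 3) - real n * (real n + 1)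
      = (real m + 2 - real n) * (real m + 3 + real n)"
    by (simp add: algebra_simps)
  moreover have "real m + 2 - real n \<noteq> 0" "real m + 3 + real n \<noteq> 0"
    using "3.prems"[of 0] by linarith+
  ultimately show ?case by (simp only: mult_eq_0_iff) simp
qed

text \<open>At \<open>m = n + 2 j\<close> the left factor of the recurrence is
  \<open>(2 j + 2) (2 n + 2 j + 3)\<close>, and it exceeds the right one by
  \<open>2 (m + 2)\<close>. Writing the quotient as 1 minus a ratio exposes the difference of
  consecutive coefficients.\<close>

lemma legendre_coeff_U_step:
  "legendre_coeff_U n (n + 2 * Suc j)
     = legendre_coeff_U n (n + 2 * j) * (1 - (n + 2 * j + 2) / ((j + 1) * (2 * n + 2 * j + 3)))"
proof -
  define a b where "a = legendre_coeff_U n (n + 2 * Suc j)" and "b = legendre_coeff_U n (n + 2 * j)"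
  have "((real n + 2 * j + 2) * (real n + 2 * j + 3) - real n * (real n + 1)) * a
      = ((real n + 2 * j + 1) * (real n + 2 * j + 2) - real n * (real n + 1)) * b"
    using legendre_coeff_U_recurrence[of "n + 2 * j" n] by (simp add: a_def b_def algebra_simps)
  then have "2 * ((real j + 1) * (2 * n + 2 * j + 3) * a)
     = 2 * (((real j + 1) * (2 * n + 2 * j + 3) - (n + 2 * j + 2)) * b)"
    by (simp add: algebra_simps)
  moreover have "(real j + 1) * (2 * n + 2 * j + 3) > 0"
    by (intro mult_pos_pos) linarith+
  ultimately show ?thesis
    unfolding a_def[symmetric] b_def[symmetric] by (simp add: field_simps)
qed

lemma legendre_coeff_U_step_ratio:
  fixes n j :: nat
  defines "r \<equiv> (real n + 2 * j + 2) / ((real j + 1) * (2 * n + 2 * j + 3))"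
  shows "0 \<le> r" "r \<le> (n + 2) / (2 * n + 3)"
proof -
  show "0 \<le> r" by (simp add: r_def)
  have "r = (real n + 2 * j + 2) / (real j + 1) / (2 * n + 2 * j + 3)"
    by (simp add: r_def)
  \<comment> \<open>The numerator equals \<open>2 + n / (j + 1)\<close>, so the ratio is largest at
    \<open>j = 0\<close>.\<close>
  also have "\<dots> \<le> (real n + 2) / (2 * n + 3)"
  proof (rule frac_le)
    show "(real n + 2 * j + 2) / (real j + 1) \<le> real n + 2"
      by (simp add: divide_simps algebra_simps)
  qed auto
  finally show "r \<le> (n + 2) / (2 * n + 3)" by (simp add: add.commute)
qed

lemma legendre_coeff_U_bounds: "0 \<le> legendre_coeff_U n (n + 2 * j)" "legendre_coeff_U n (n + 2 * j) \<le> legendre_coeff_U n n"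
proof -
  have "0 \<le> legendre_coeff_U n (n + 2 * j) \<and> legendre_coeff_U n (n + 2 * j) \<le> legendre_coeff_U n n"
  proof (induction j)
    case 0
    show ?case by (simp add: legendre_coeff_U_diag)
  next
    case (Suc j)
    let ?r = "(real n + 2 * j + 2) / ((real j + 1) * (2 * n + 2 * j + 3))"
    \<comment> \<open>This places the quotient \<open>1 - ?r\<close> of consecutive coefficients in
      [0,1], giving sign and monotonicity together.\<close>
    have "real (n + 2) / real (2 * n + 3) \<le> 1" by simp
    then have "0 \<le> ?r" "?r \<le> 1" using legendre_coeff_U_step_ratio[of n j] by linarith+
    then have "0 \<le> legendre_coeff_U n (n + 2 * j) * (1 - ?r)" "legendre_coeff_U n (n + 2 * j) * (1 - ?r) \<le> legendre_coeff_U n (n + 2 * j)"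
      using Suc by (auto intro: mult_left_le)
    then show ?case using Suc unfolding legendre_coeff_U_step by (simp add: add_ac)
  qed
  then show "0 \<le> legendre_coeff_U n (n + 2 * j)" "legendre_coeff_U n (n + 2 * j) \<le> legendre_coeff_U n n" by auto
qed

text \<open>\<open>cheb_E k\<close> is twice the Chebyshev polynomial of the first kind, except that
  \<open>cheb_E 0 = 1\<close>.\<close>

definition cheb_E :: "nat \<Rightarrow> real poly" where
  "cheb_E k = (if k < 2 then cheb_U k else cheb_U k - cheb_U (k - 2))"

definition legendre_coeff_E :: "nat \<Rightarrow> nat \<Rightarrow> real" where
  "legendre_coeff_E n k = (2 * real n + 1) / 2 * poly_integral (legendre_poly n * cheb_E k)"

lemma legendre_coeff_E_eq: "legendre_coeff_E n k = (if k < 2 then legendre_coeff_U n k else legendre_coeff_U n k - legendre_coeff_U n (k - 2))"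
  by (simp add: legendre_coeff_E_def legendre_coeff_U_def cheb_E_def right_diff_distrib poly_integral_diff
      del: cheb_U.simps)

lemma legendre_coeff_E_eq_0:
  assumes "n \<ge> 1" "\<And>j. k \<noteq> n + 2 * j"
  shows "legendre_coeff_E n k = 0"
proof (cases "k < 2")
  case False
  have "k - 2 \<noteq> n + 2 * j" for j using assms(2)[of "Suc j"] False by auto
  then show ?thesis using assms by (simp add: legendre_coeff_E_eq legendre_coeff_U_eq_0)
qed (use assms in \<open>simp add: legendre_coeff_E_eq legendre_coeff_U_eq_0\<close>)

lemma legendre_coeff_E_diag:
  assumes "n \<ge> 1"
  shows "legendre_coeff_E n n = legendre_coeff_U n n"
proof -
  \<comment> \<open>The subtracted polynomial has degree below \<open>n\<close>; for
    \<open>n = 1\<close> nothing is subtracted.\<close>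
  have "legendre_coeff_U n (n - 2) = 0" if "n \<ge> 2" using assms that by (intro legendre_coeff_U_eq_0) auto
  then show ?thesis by (simp add: legendre_coeff_E_eq)
qed

text \<open>The difference of consecutive coefficients is minus the earlier one times the step
  ratio, and both factors are bounded by their values at \<open>j = 0\<close>.\<close>

lemma legendre_coeff_E_bound: "\<bar>legendre_coeff_E n (n + 2 * Suc j)\<bar> \<le> legendre_coeff_U n n * ((n + 2) / (2 * n + 3))"
proof -
  let ?r = "(real n + 2 * j + 2) / ((real j + 1) * (2 * n + 2 * j + 3))"
  have "n + 2 * Suc j - 2 = n + 2 * j" "\<not> n + 2 * Suc j < 2" by auto
  then have "legendre_coeff_E n (n + 2 * Suc j) = - (legendre_coeff_U n (n + 2 * j) * ?r)"
    unfolding legendre_coeff_E_eq legendre_coeff_U_step by (simp add: algebra_simps)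
  then have "\<bar>legendre_coeff_E n (n + 2 * Suc j)\<bar> = legendre_coeff_U n (n + 2 * j) * ?r"
    using legendre_coeff_U_step_ratio(1)[of n j] legendre_coeff_U_bounds(1)[of n j] by simp
  also have "\<dots> \<le> legendre_coeff_U n n * ((n + 2) / (2 * n + 3))"
    using legendre_coeff_U_step_ratio[of n j] legendre_coeff_U_bounds[of n j] legendre_coeff_U_bounds(1)[of n 0]
    by (intro mult_mono) auto
  finally show ?thesis by (simp add: add.commute)
qed

section \<open>Estimating the leading coefficient by Wallis' product\<close>

lemma legendre_coeff_U_diag_wallis:
  "(legendre_coeff_U n n)\<^sup>2 = (2 * real n + 1) * (\<Prod>k=1..n. (4 * real k ^ 2) / (4 * real k ^ 2 - 1))"
proof (induction n)
  case 0
  show ?case by (simp add: legendre_coeff_U_diag)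
next
  case (Suc n)
  \<comment> \<open>The square of this quotient is the next Wallis factor times
    \<open>(2 n + 3) / (2 n + 1)\<close>; the latter telescopes to \<open>2 n + 1\<close>.\<close>
  have "legendre_coeff_U (Suc n) (Suc n) = legendre_coeff_U n n * ((2 * real n + 2) / (2 * real n + 1))"
    unfolding legendre_coeff_U_diag
    by (simp add: divide_simps power2_eq_square) (simp add: algebra_simps)
  then have "(legendre_coeff_U (Suc n) (Suc n))\<^sup>2 = (legendre_coeff_U n n)\<^sup>2 * ((2 * real n + 2) / (2 * real n + 1))\<^sup>2"
    by (simp only: power_mult_distrib)
  moreover have "(\<Prod>k=1..Suc n. (4 * real k ^ 2) / (4 * real k ^ 2 - 1))
      = (4 * real (Suc n) ^ 2) / (4 * real (Suc n) ^ 2 - 1) * (\<Prod>k=1..n. (4 * real k ^ 2) / (4 * real k ^ 2 - 1))"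
    by (rule prod.nat_ivl_Suc') simp
  moreover have "4 * real (Suc n) ^ 2 = (2 * real n + 2)\<^sup>2"
    by (simp add: power2_eq_square algebra_simps)
  moreover have "4 * real (Suc n) ^ 2 - 1 = (2 * real n + 1) * (2 * real (Suc n) + 1)"
    by (simp add: power2_eq_square algebra_simps)
  ultimately show ?case
    unfolding Suc by (simp add: power2_eq_square)
qed

text \<open>All Wallis factors are at least 1, so the partial products increase to
  \<open>pi / 2\<close> and stay below it.\<close>

lemma legendre_coeff_U_diag_le: "legendre_coeff_U n n \<le> sqrt (pi * (real n + 1 / 2))"
proof (rule real_le_rsqrt)
  let ?P = "\<lambda>n. \<Prod>k=1..n. (4 * real k ^ 2) / (4 * real k ^ 2 - 1)"
  have fac: "1 \<le> (4 * real k ^ 2) / (4 * real k ^ 2 - 1)" if "k \<ge> 1" for k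
  proof -
    have "1 \<le> real k ^ 2" using that by simp
    then show ?thesis by simp
  qed
  have "incseq ?P"
  proof (rule incseq_SucI)
    fix n
    have "0 \<le> ?P n" by (intro prod_nonneg) (use fac in force)
    then have "?P n * 1 \<le> ?P n * ((4 * real (Suc n) ^ 2) / (4 * real (Suc n) ^ 2 - 1))"
      by (intro mult_left_mono fac) auto
    then show "?P n \<le> ?P (Suc n)" by (simp add: prod.nat_ivl_Suc' mult.commute)
  qed
  then have "?P n \<le> pi / 2" using wallis by (rule incseq_le)
  then have "(2 * real n + 1) * ?P n \<le> (2 * real n + 1) * (pi / 2)"
    by (intro mult_left_mono) auto
  then show "(legendre_coeff_U n n)\<^sup>2 \<le> pi * (real n + 1 / 2)"
    unfolding legendre_coeff_U_diag_wallis by (simp add: algebra_simps)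
qed

text \<open>The factor to absorb is \<open>sqrt (1 + 1 / (2 n))\<close>. The exponent
  \<open>e\<close> is at least \<open>1 / (4 n)\<close>, and
  \<open>1 + 2 e \<le> exp (2 e)\<close>.\<close>

lemma legendre_coeff_U_diag_le_exp:
  assumes "n \<ge> 1"
  shows "legendre_coeff_U n n \<le> sqrt (pi * real n) * exp ((8 * real n - 1) / (12 * real n * (2 * real n - 1)))"
proof -
  define e where "e = (8 * real n - 1) / (12 * real n * (2 * real n - 1))"
  have n: "real n \<ge> 1" using assms by simp
  have "1 / (4 * real n) = (3 * (2 * real n - 1)) / (12 * real n * (2 * real n - 1))"
    using n by (simp add: divide_simps)
  also have "\<dots> \<le> e"
    unfolding e_def using n by (intro divide_right_mono) auto
  finally have "1 + 1 / (2 * real n) \<le> 1 + 2 * e" by simp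
  also have "\<dots> \<le> exp (2 * e)" by (rule exp_ge_add_one_self)
  also have "\<dots> = (exp e)\<^sup>2" by (rule exp_double)
  finally have "1 + 1 / (2 * real n) \<le> (exp e)\<^sup>2" .
  then have "pi * (real n + 1 / 2) \<le> pi * real n * (exp e)\<^sup>2"
  proof -
    assume "1 + 1 / (2 * real n) \<le> (exp e)\<^sup>2"
    then have "pi * real n * (1 + 1 / (2 * real n)) \<le> pi * real n * (exp e)\<^sup>2"
      using n by (intro mult_left_mono) auto
    moreover have "pi * real n * (1 + 1 / (2 * real n)) = pi * (real n + 1 / 2)"
      using n by (simp add: field_simps)
    ultimately show ?thesis by simp
  qed
  then have "sqrt (pi * (real n + 1 / 2)) \<le> sqrt (pi * real n * (exp e)\<^sup>2)" by simp
  also have "\<dots> = sqrt (pi * real n) * exp e" by (simp add: real_sqrt_mult)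
  finally show ?thesis using legendre_coeff_U_diag_le[of n] unfolding e_def by linarith
qed

subsection \<open>The Chebyshev expansion on the Bernstein ellipse\<close>

lemma sums_integral_Weierstrass:
  fixes f :: "nat \<Rightarrow> real \<Rightarrow> complex"
  assumes cont: "\<And>k. continuous_on {a..b} (f k)"
    and bound: "\<And>k x. x \<in> {a..b} \<Longrightarrow> norm (f k x) \<le> m k" and "summable m"
    and sums: "\<And>x. x \<in> {a..b} \<Longrightarrow> (\<lambda>k. f k x) sums g x"
  shows "(\<lambda>k. integral {a..b} (f k)) sums integral {a..b} g"
proof -
  have "uniform_limit {a..b} (\<lambda>n x. \<Sum>i<n. f i x) (\<lambda>x. suminf (\<lambda>i. f i x)) sequentially"
    using bound \<open>summable m\<close> by (rule Weierstrass_m_test)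
  also have "?this \<longleftrightarrow> uniform_limit {a..b} (\<lambda>n x. \<Sum>i<n. f i x) g sequentially"
    using sums by (intro uniform_limit_cong') (auto simp: sums_iff)
  finally obtain I J where IJ: "\<And>n. ((\<lambda>x. \<Sum>i<n. f i x) has_integral I n) {a..b}"
      "(g has_integral J) {a..b}" "I \<longlonglongrightarrow> J"
    by (rule uniform_limit_integral) (auto intro!: continuous_intros cont)
  have "I = (\<lambda>n. \<Sum>i<n. integral {a..b} (f i))"
  proof
    fix n
    show "I n = (\<Sum>i<n. integral {a..b} (f i))"
    using IJ(1)[of n]
    by (rule has_integral_unique)
       (intro has_integral_sum integrable_integral integrable_continuous_real cont finite_lessThan)
  qed
  then show ?thesis
    using IJ(2,3) by (simp add: sums_def integral_unique)
qed

text \<open>The differences of \<open>cheb_U\<close> two indices apart obey the same three-term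
  recurrence as the cosines of multiples of \<phi>. This avoids dividing by
  \<open>sin \<phi>\<close>.\<close>

lemma poly_cheb_E_cos:
  "poly (cheb_E k) (cos \<phi>) = (if k = 0 then 1 else 2 * cos (real k * \<phi>))"
proof -
  let ?U = "\<lambda>k. poly (cheb_U k) (cos \<phi>)"
  have rec: "2 * cos \<phi> * cos (real (Suc k) * \<phi>) - cos (real k * \<phi>) = cos (real (Suc (Suc k)) * \<phi>)" for k
  proof -
    define A where "A = real (Suc k) * \<phi>"
    have "real (Suc (Suc k)) * \<phi> = A + \<phi>" "real k * \<phi> = A - \<phi>" "real (Suc k) * \<phi> = A"
      by (simp_all add: A_def algebra_simps)
    then show ?thesis by (simp only: cos_add cos_diff) (simp add: algebra_simps)
  qed
  have "?U (Suc (Suc k)) - ?U k = 2 * cos (real (Suc (Suc k)) * \<phi>)" for k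
  proof (induction k rule: cheb_U.induct)
    case 1
    show ?case using rec[of 0] by (simp add: algebra_simps)
  next
    case 2
    show ?case using rec[of 0] rec[of 1] by (simp add: algebra_simps) algebra
  next
    case (3 k)
    have "?U (Suc (Suc (Suc (Suc k)))) - ?U (Suc (Suc k))
      = 2 * cos \<phi> * (?U (Suc (Suc (Suc k))) - ?U (Suc k)) - (?U (Suc (Suc k)) - ?U k)"
      by (simp add: algebra_simps)
    then show ?case unfolding 3 using rec[of "Suc (Suc k)"] by simp
  qed
  from this[of "k - 2"] show ?thesis
    by (cases k rule: cheb_U.cases) (auto simp: cheb_E_def simp del: cheb_U.simps(3))
qed

lemma cheb_E_bound:
  assumes "x \<in> {-1..1}"
  shows "\<bar>poly (cheb_E k) x\<bar> \<le> 2"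
  using poly_cheb_E_cos[of k "arccos x"] assms abs_cos_le_one[of "real k * arccos x"]
  by (auto simp: cos_arccos abs_mult split: if_splits)

text \<open>With \<open>x = cos \<phi>\<close> the series splits into two geometric series with
  ratios \<open>cis \<phi> / w\<close> and \<open>cis (- \<phi>) / w\<close>. The denominator
  factors through \<open>w - a\<close> and \<open>w - b\<close>, nonzero because \<open>w\<close>
  lies outside the unit circle.\<close>

lemma cheb_E_generating:
  fixes w :: complex and x :: real
  assumes "norm w > 1" "x \<in> {-1..1}"
  shows "(\<lambda>k. of_real (poly (cheb_E k) x) / w ^ k) sums ((w - inverse w) / (w + inverse w - 2 * of_real x))"
    and "w + inverse w \<noteq> 2 * of_real x"
proof -
  define \<phi> where "\<phi> = arccos x"
  have x: "x = cos \<phi>" using assms by (simp add: \<phi>_def cos_arccos)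
  define a b where "a = cis \<phi>" and "b = cis (- \<phi>)"
  have ab: "a * b = 1" "a + b = 2 * of_real x"
    by (simp_all add: a_def b_def cis_mult x complex_eq_iff)
  have w0: "w \<noteq> 0" using assms by auto
  have lt: "norm (a / w) < 1" "norm (b / w) < 1"
    using assms by (simp_all add: a_def b_def norm_divide divide_simps)
  have ne: "w - a \<noteq> 0" "w - b \<noteq> 0" using assms by (auto simp: a_def b_def)
  have fac: "w * (w + inverse w - 2 * of_real x) = (w - a) * (w - b)"
    using w0 ab by (simp add: algebra_simps) algebra
  then show "w + inverse w \<noteq> 2 * of_real x" using ne by auto
  \<comment> \<open>Both geometric series contribute 1 at \<open>k = 0\<close>, whereas
    \<open>cheb_E 0 = 1\<close>; hence the correction by 1.\<close>
  have "(\<lambda>k. (a / w) ^ k + (b / w) ^ k - (if k = 0 then 1 else 0))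
      sums (1 / (1 - a / w) + 1 / (1 - b / w) - 1)"
    using sums_single[of 0 "\<lambda>_. 1 :: complex"]
    by (intro sums_diff sums_add geometric_sums lt) simp
  moreover have "(a / w) ^ k + (b / w) ^ k - (if k = 0 then 1 else 0) = of_real (poly (cheb_E k) x) / w ^ k" for k
  proof -
    have "a ^ k + b ^ k = 2 * of_real (cos (real k * \<phi>))"
      by (simp add: a_def b_def complex_eq_iff flip: cos_n_Re_cis_pow_n sin_n_Im_cis_pow_n)
    then show ?thesis
      unfolding x poly_cheb_E_cos by (simp add: power_divide flip: add_divide_distrib)
  qed
  moreover have "1 / (1 - a / w) + 1 / (1 - b / w) - 1 = (w - inverse w) / (w + inverse w - 2 * of_real x)"
  proof -
    have "1 / (1 - a / w) + 1 / (1 - b / w) - 1 = w / (w - a) + w / (w - b) - 1"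
      using w0 by (simp add: divide_simps)
    also have "\<dots> = (w * (w - b) + w * (w - a) - (w - a) * (w - b)) / ((w - a) * (w - b))"
      using ne by (simp add: divide_simps)
    also have "w * (w - b) + w * (w - a) - (w - a) * (w - b) = w * (w - inverse w)"
      using w0 ab by (simp add: algebra_simps)
    finally show ?thesis
      unfolding fac[symmetric] using w0 by simp
  qed
  ultimately show "(\<lambda>k. of_real (poly (cheb_E k) x) / w ^ k)
      sums ((w - inverse w) / (w + inverse w - 2 * of_real x))"
    by simp
qed

section \<open>The Bernstein ellipse as a closed contour\<close>

locale bernstein =
  fixes \<rho> :: real
  assumes rho: "\<rho> > 1"
begin

text \<open>The circle is traversed over [0,1], the parameter interval of paths, rather than over an
  angle.\<close>

definition w :: "real \<Rightarrow> complex" where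
  "w t = of_real \<rho> * exp (2 * of_real pi * \<i> * of_real t)"

definition \<gamma> :: "real \<Rightarrow> complex" where
  "\<gamma> t = (w t + inverse (w t)) / 2"

text \<open>Since \<open>dw = 2 pi \<i> w dt\<close>, this is the coefficient integral of
  \<open>f ((w + 1/w) / 2) / w^(k + 1)\<close> over the circle, divided by
  \<open>2 pi \<i>\<close>.\<close>

definition cheb_coeff :: "(complex \<Rightarrow> complex) \<Rightarrow> nat \<Rightarrow> complex" where
  "cheb_coeff f k = integral {0..1} (\<lambda>t. f (\<gamma> t) / w t ^ k)"

lemma norm_w [simp]: "norm (w t) = \<rho>"
  using rho by (simp add: w_def norm_mult)

lemma w_nonzero [simp]: "w t \<noteq> 0"
  using norm_w[of t] rho by (metis norm_zero not_one_less_zero)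

lemma continuous_w [continuous_intros]: "continuous_on A w"
  unfolding w_def[abs_def] by (intro continuous_intros)

lemma continuous_gamma [continuous_intros]: "continuous_on A \<gamma>"
  unfolding \<gamma>_def[abs_def] by (intro continuous_intros) auto

lemma has_vector_derivative_gamma:
  "(\<gamma> has_vector_derivative (pi * \<i> * (w t - inverse (w t)))) (at t)"
proof -
  have dw: "(w has_vector_derivative (2 * pi * \<i> * w t)) (at t)"
  proof -
    have "((\<lambda>z. of_real \<rho> * exp (2 * of_real pi * \<i> * z)) has_field_derivative
        (2 * pi * \<i> * w t)) (at (of_real t))"
      by (auto intro!: derivative_eq_intros simp: w_def)
    from has_vector_derivative_real_field[OF this] show ?thesis
      by (simp add: w_def[abs_def])
  qed
  have "((\<lambda>z. (z + inverse z) / 2) has_field_derivative ((1 - inverse (w t ^ 2)) / 2)) (at (w t))"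
    by (auto intro!: derivative_eq_intros simp: power2_eq_square field_simps)
  from field_vector_diff_chain_at[OF dw this]
  have "(\<gamma> has_vector_derivative (2 * pi * \<i> * w t * ((1 - inverse (w t ^ 2)) / 2))) (at t)"
    by (simp add: \<gamma>_def[abs_def] o_def)
  moreover have "2 * pi * \<i> * w t * ((1 - inverse (w t ^ 2)) / 2) = pi * \<i> * (w t - inverse (w t))"
    by (simp add: field_simps power2_eq_square)
  ultimately show ?thesis by (simp only:)
qed

lemma vector_derivative_gamma: "vector_derivative \<gamma> (at t) = pi * \<i> * (w t - inverse (w t))"
  by (rule vector_derivative_at[OF has_vector_derivative_gamma])

lemma valid_path_gamma: "valid_path \<gamma>"
  unfolding valid_path_def
proof (rule C1_differentiable_imp_piecewise)
  show "\<gamma> C1_differentiable_on {0..1}"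
    unfolding C1_differentiable_on_eq vector_derivative_gamma
    by (auto intro!: continuous_intros differentiableI_vector has_vector_derivative_gamma)
qed

lemma w_1_eq_w_0: "w 1 = w 0"
  by (simp add: w_def)

lemma pathfinish_gamma: "pathfinish \<gamma> = pathstart \<gamma>"
  by (simp add: pathfinish_def pathstart_def \<gamma>_def w_1_eq_w_0)

lemma path_image_gamma: "path_image \<gamma> = bernstein_ellipse \<rho>"
proof -
  have "path_image \<gamma> = (\<lambda>\<theta>. (of_real \<rho> * exp (\<i> * of_real \<theta>) +
      inverse (of_real \<rho> * exp (\<i> * of_real \<theta>))) / 2) ` ((\<lambda>t. 2 * pi * t) ` {0..1})"
    unfolding path_image_def image_image \<gamma>_def w_def by (simp add: mult_ac)
  also have "(\<lambda>t. 2 * pi * t) ` {0..1} = {0..2 * pi}"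
    using image_mult_atLeastAtMost[of "2 * pi" 0 1] by simp
  finally show ?thesis by (auto simp: bernstein_ellipse_def)
qed

lemma real_notin_ellipse: "x \<in> {-1..1} \<Longrightarrow> of_real x \<notin> bernstein_ellipse \<rho>"
proof
  assume x: "x \<in> {-1..1}" and "of_real x \<in> bernstein_ellipse \<rho>"
  then obtain t where "of_real x = \<gamma> t"
    unfolding path_image_gamma[symmetric] path_image_def by auto
  then have "2 * of_real x = 2 * \<gamma> t" by simp
  also have "\<dots> = w t + inverse (w t)" by (simp add: \<gamma>_def)
  finally show False
    using cheb_E_generating(2)[of "w t" x] rho x by simp
qed

text \<open>Along the contour \<open>dz / (z - x)\<close> is \<open>2 pi \<i> K t dt\<close>, and
  \<open>K\<close> is the sum of the generating series, integrated termwise. Mere continuity of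
  \<open>f\<close> is assumed; the cases used are \<open>u\<close> and the constant 1.\<close>

lemma contour_integral_cauchy_kernel:
  assumes f: "continuous_on (bernstein_ellipse \<rho>) f" and x: "x \<in> {-1..1}"
  shows "(\<lambda>k. of_real (poly (cheb_E k) x) * cheb_coeff f k) sums
    (contour_integral \<gamma> (\<lambda>z. f z / (z - of_real x)) / (2 * pi * \<i>))"
proof -
  have fg: "continuous_on {0..1} (\<lambda>t. f (\<gamma> t))"
    using f continuous_gamma
    by (rule continuous_on_compose2) (auto simp: path_image_gamma[symmetric] path_image_def)
  have "compact ((\<lambda>t. f (\<gamma> t)) ` {0..1})"
    using fg by (rule compact_continuous_image) simp
  then obtain B where B: "\<And>t. t \<in> {0..1} \<Longrightarrow> norm (f (\<gamma> t)) \<le> B"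
    by (meson bounded_iff compact_imp_bounded imageI)
  have B0: "B \<ge> 0" using B[of 0] norm_ge_zero order_trans by (metis atLeastAtMost_iff order_refl zero_le_one)
  define K where "K t = (w t - inverse (w t)) / (w t + inverse (w t) - 2 * of_real x)" for t
  have "(\<lambda>k. integral {0..1} (\<lambda>t. f (\<gamma> t) * (of_real (poly (cheb_E k) x) / w t ^ k)))
      sums integral {0..1} (\<lambda>t. f (\<gamma> t) * K t)"
  proof (rule sums_integral_Weierstrass)
    show "continuous_on {0..1} (\<lambda>t. f (\<gamma> t) * (of_real (poly (cheb_E k) x) / w t ^ k))" for k
      by (intro continuous_intros fg) auto
    show "norm (f (\<gamma> t) * (of_real (poly (cheb_E k) x) / w t ^ k)) \<le> B * (2 * (1 / \<rho>) ^ k)"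
      if "t \<in> {0..1}" for k t
      using B[OF that] cheb_E_bound[OF x, of k] rho B0
      by (auto simp: norm_mult norm_inverse norm_power power_inverse divide_inverse
          intro!: mult_mono)
    show "summable (\<lambda>k. B * (2 * (1 / \<rho>) ^ k))"
      using rho by (intro summable_mult summable_geometric) auto
    show "(\<lambda>k. f (\<gamma> t) * (of_real (poly (cheb_E k) x) / w t ^ k)) sums (f (\<gamma> t) * K t)" for t
      unfolding K_def using rho x by (intro sums_mult cheb_E_generating) auto
  qed
  moreover have "integral {0..1} (\<lambda>t. f (\<gamma> t) * (of_real (poly (cheb_E k) x) / w t ^ k))
      = of_real (poly (cheb_E k) x) * cheb_coeff f k" for k
    unfolding cheb_coeff_def by (subst integral_mult_right[symmetric]) (simp add: mult_ac)
  moreover have "integral {0..1} (\<lambda>t. f (\<gamma> t) * K t)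
      = contour_integral \<gamma> (\<lambda>z. f z / (z - of_real x)) / (2 * pi * \<i>)"
  proof -
    have "f (\<gamma> t) / (\<gamma> t - of_real x) * vector_derivative \<gamma> (at t) = 2 * pi * \<i> * (f (\<gamma> t) * K t)" for t
    proof -
      have "\<gamma> t - of_real x = (w t + inverse (w t) - 2 * of_real x) / 2"
        by (simp add: \<gamma>_def field_simps)
      then show ?thesis
        unfolding vector_derivative_gamma K_def by (simp only: divide_divide_eq_right) simp
    qed
    then show ?thesis
      unfolding contour_integral_integral by simp
  qed
  ultimately show ?thesis by simp
qed

text \<open>For \<open>k > 0\<close> the antiderivative is an exponential of period 1, so its
  endpoint values cancel.\<close>

lemma integral_w_power:
  "integral {0..1} (\<lambda>t. 1 / w t ^ k) = (if k = 0 then 1 else 0)"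
proof (cases "k = 0")
  case False
  define c where "c = - (2 * of_real pi * \<i> * of_nat k)"
  have c: "c \<noteq> 0" using False by (simp add: c_def)
  have w: "1 / w t ^ k = exp (c * of_real t) / of_real \<rho> ^ k" for t
    by (simp add: w_def c_def power_mult_distrib exp_of_nat_mult[symmetric] exp_minus divide_inverse mult_ac)
  have "((\<lambda>t. 1 / w t ^ k) has_integral
      (exp (c * of_real 1) / (c * of_real \<rho> ^ k) - exp (c * of_real 0) / (c * of_real \<rho> ^ k))) {0..1}"
  proof (rule fundamental_theorem_of_calculus)
    fix t :: real
    have "((\<lambda>z. exp (c * z) / (c * of_real \<rho> ^ k)) has_field_derivative (1 / w t ^ k)) (at (of_real t))"
      unfolding w using c rho by (auto intro!: derivative_eq_intros)
    then show "((\<lambda>t. exp (c * of_real t) / (c * of_real \<rho> ^ k)) has_vector_derivative (1 / w t ^ k))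
        (at t within {0..1})"
      by (rule has_vector_derivative_real_field[THEN has_vector_derivative_at_within])
  qed simp
  moreover have "exp (c * of_real 1) = 1"
    by (simp add: c_def exp_minus exp_of_nat_mult mult_ac)
  ultimately show ?thesis using False by (simp add: integral_unique)
qed simp

text \<open>The kernel expansion for the constant 1 computes the winding number: only the term
  \<open>k = 0\<close> survives.\<close>

lemma winding_number_gamma:
  assumes x: "x \<in> {-1..1}"
  shows "winding_number \<gamma> (of_real x) = 1"
proof -
  have "(\<lambda>k. of_real (poly (cheb_E k) x) * cheb_coeff (\<lambda>_. 1) k) sums winding_number \<gamma> (of_real x)"
    using contour_integral_cauchy_kernel[OF continuous_on_const x, of 1]
      winding_number_valid_path[OF valid_path_gamma] real_notin_ellipse[OF x]
    by (simp add: path_image_gamma)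
  moreover have "(\<lambda>k. of_real (poly (cheb_E k) x) * cheb_coeff (\<lambda>_. 1) k) = (\<lambda>k. if k = 0 then 1 else 0)"
    by (auto simp: cheb_coeff_def integral_w_power cheb_E_def)
  ultimately show ?thesis
    using sums_single[of 0 "\<lambda>_. 1 :: complex"] by (simp add: sums_iff)
qed

text \<open>A point in the outside component would have winding number 0.\<close>

lemma real_in_inside:
  assumes "x \<in> {-1..1}"
  shows "of_real x \<in> inside (bernstein_ellipse \<rho>)"
proof (rule ccontr)
  assume "of_real x \<notin> inside (bernstein_ellipse \<rho>)"
  then have "of_real x \<in> outside (path_image \<gamma>)"
    using real_notin_ellipse[OF assms] by (auto simp: path_image_gamma inside_outside)
  then have "winding_number \<gamma> (of_real x) = 0"
    by (intro winding_number_zero_in_outside valid_path_imp_path valid_path_gamma pathfinish_gamma)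
  then show False using winding_number_gamma[OF assms] by simp
qed

lemma chebyshev_expansion:
  assumes u: "u \<in> bernstein_analytic \<rho>" and x: "x \<in> {-1..1}"
  shows "(\<lambda>k. of_real (poly (cheb_E k) x) * cheb_coeff u k) sums u (of_real x)"
proof -
  obtain S where S: "open S" "bernstein_ellipse \<rho> \<union> inside (bernstein_ellipse \<rho>) \<subseteq> S" "u holomorphic_on S"
    using u by (auto simp: bernstein_analytic_def analytic_on_holomorphic)
  have "((\<lambda>z. u z / (z - of_real x)) has_contour_integral
      (2 * pi * \<i> * winding_number \<gamma> (of_real x) * u (of_real x))) \<gamma>"
  proof (rule Cauchy_integral_formula_global[OF S(1,3) _ valid_path_gamma _ pathfinish_gamma])
    show "of_real x \<in> S" using S(2) real_in_inside[OF x] by auto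
    show "path_image \<gamma> \<subseteq> S - {of_real x}"
      using S(2) real_notin_ellipse[OF x] by (auto simp: path_image_gamma)
    \<comment> \<open>\<open>S\<close> contains the ellipse and its inside, so a point off
      \<open>S\<close> lies outside. This is the topological hypothesis of the global Cauchy
      formula.\<close>
    show "winding_number \<gamma> z = 0" if "z \<notin> S" for z
    proof (rule winding_number_zero_in_outside)
      show "z \<in> outside (path_image \<gamma>)"
        using that S(2) by (auto simp: path_image_gamma outside_inside)
    qed (auto intro: valid_path_imp_path valid_path_gamma pathfinish_gamma)
  qed
  then have "contour_integral \<gamma> (\<lambda>z. u z / (z - of_real x)) / (2 * pi * \<i>) = u (of_real x)"
    by (simp add: contour_integral_unique winding_number_gamma[OF x])
  moreover have "continuous_on (bernstein_ellipse \<rho>) u"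
    using S by (meson holomorphic_on_imp_continuous_on continuous_on_subset le_sup_iff)
  ultimately show ?thesis
    using contour_integral_cauchy_kernel[OF _ x, of u] by simp
qed

section \<open>From Chebyshev to Legendre coefficients of \<open>u\<close>\<close>

lemma cheb_coeff_bound:
  assumes "continuous_on (bernstein_ellipse \<rho>) u" "\<And>z. z \<in> bernstein_ellipse \<rho> \<Longrightarrow> norm (u z) \<le> M"
  shows "norm (cheb_coeff u k) \<le> M / \<rho> ^ k"
proof -
  have img: "\<gamma> t \<in> bernstein_ellipse \<rho>" if "t \<in> {0..1}" for t
    using that by (auto simp: path_image_gamma[symmetric] path_image_def)
  have "norm (cheb_coeff u k) \<le> M / \<rho> ^ k * (1 - 0)"
    unfolding cheb_coeff_def
  proof (rule integral_bound)
    have "continuous_on {0..1} (\<lambda>t. u (\<gamma> t))"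
      using assms(1) continuous_gamma by (rule continuous_on_compose2) (use img in auto)
    then show "continuous_on {0..1} (\<lambda>t. u (\<gamma> t) / w t ^ k)"
      by (intro continuous_intros) auto
    show "norm (u (\<gamma> t) / w t ^ k) \<le> M / \<rho> ^ k" if "t \<in> {0..1}" for t
      using assms(2)[OF img[OF that]] rho by (simp add: norm_divide norm_power divide_right_mono)
  qed simp
  then show ?thesis by simp
qed

text \<open>The Chebyshev expansion is multiplied by the Legendre polynomial and integrated
  termwise, with a geometric majorant in \<open>1 / \<rho>\<close>.\<close>

lemma legendre_coeff_sums:
  assumes u: "u \<in> bernstein_analytic \<rho>" and M: "\<And>k. norm (cheb_coeff u k) \<le> M / \<rho> ^ k"
  shows "(\<lambda>k. of_real (legendre_coeff_E n k) * cheb_coeff u k) sums legendre_coeff u n"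
proof -
  let ?L = "poly (legendre_poly n)"
  have "compact (?L ` {-1..1})"
    by (intro compact_continuous_image continuous_intros) simp
  then obtain B where B: "\<And>x. x \<in> {-1..1} \<Longrightarrow> norm (?L x) \<le> B"
    by (meson bounded_iff compact_imp_bounded imageI)
  have M0: "M \<ge> 0" using M[of 0] by (simp, metis norm_ge_zero order_trans)
  have "(\<lambda>k. integral {-1..1} (\<lambda>x. of_real (poly (cheb_E k) x) * cheb_coeff u k * of_real (?L x)))
      sums integral {-1..1} (\<lambda>x. u (of_real x) * of_real (?L x))"
  proof (rule sums_integral_Weierstrass)
    show "continuous_on {-1..1} (\<lambda>x. of_real (poly (cheb_E k) x) * cheb_coeff u k * of_real (?L x) :: complex)" for k
      by (intro continuous_intros)
    show "norm (of_real (poly (cheb_E k) x) * cheb_coeff u k * of_real (?L x)) \<le> 2 * (M * (1 / \<rho>) ^ k) * B"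
      if "x \<in> {-1..1}" for k x
      unfolding norm_mult norm_of_real
      using B[OF that] cheb_E_bound[OF that, of k] M[of k] M0 rho
      by (intro mult_mono) (auto simp: power_inverse divide_inverse)
    show "summable (\<lambda>k. 2 * (M * (1 / \<rho>) ^ k) * B)"
      using rho by (intro summable_mult summable_mult2 summable_geometric) auto
    show "(\<lambda>k. of_real (poly (cheb_E k) x) * cheb_coeff u k * of_real (?L x)) sums (u (of_real x) * of_real (?L x))"
      if "x \<in> {-1..1}" for x
      by (intro sums_mult2 chebyshev_expansion u that)
  qed
  moreover have "integral {-1..1} (\<lambda>x. of_real (poly (cheb_E k) x) * cheb_coeff u k * of_real (?L x))
     = of_real (poly_integral (legendre_poly n * cheb_E k)) * cheb_coeff u k" for k
  proof -
    have "integral {-1..1} (complex_of_real \<circ> poly (legendre_poly n * cheb_E k))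
        = of_real (poly_integral (legendre_poly n * cheb_E k))"
      unfolding poly_integral_def by (rule integral_linear) (auto intro: bounded_linear_of_real)
    moreover have "(\<lambda>x. of_real (poly (cheb_E k) x) * cheb_coeff u k * of_real (?L x))
        = (\<lambda>x. (complex_of_real \<circ> poly (legendre_poly n * cheb_E k)) x * cheb_coeff u k)"
      by (auto simp: mult_ac)
    ultimately show ?thesis by (simp only: integral_mult_left)
  qed
  ultimately have "(\<lambda>k. (2 * of_nat n + 1) / 2 * (of_real (poly_integral (legendre_poly n * cheb_E k)) * cheb_coeff u k))
    sums legendre_coeff u n"
    unfolding legendre_coeff_def by (intro sums_mult) simp
  then show ?thesis by (simp add: legendre_coeff_E_def mult_ac)
qed

lemma legendre_coeff_bound:
  assumes u: "u \<in> bernstein_analytic \<rho>" and M: "\<And>k. norm (cheb_coeff u k) \<le> M / \<rho> ^ k"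
    and n: "n \<ge> 1"
  shows "norm (legendre_coeff u n)
    \<le> M * legendre_coeff_U n n / \<rho> ^ n * (1 + (real n + 2) / (2 * real n + 3) * (1 / (\<rho>\<^sup>2 - 1)))"
proof -
  define s where "s = (real n + 2) / (2 * real n + 3)"
  define f where "f k = of_real (legendre_coeff_E n k) * cheb_coeff u k" for k
  define C where "C = M * legendre_coeff_U n n / \<rho> ^ n"
  have \<sigma>: "legendre_coeff_U n n \<ge> 0" using legendre_coeff_U_bounds(1)[of n 0] by simp
  have M0: "M \<ge> 0" using M[of 0] by (simp, metis norm_ge_zero order_trans)
  have fn: "norm (f n) \<le> C"
    using mult_left_mono[OF M \<sigma>, of n] \<sigma> by (simp add: f_def norm_mult legendre_coeff_E_diag[OF n] C_def mult_ac)
  have fj: "norm (f (n + 2 * Suc j)) \<le> C * s * (1 / \<rho>\<^sup>2) ^ Suc j" for j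
  proof -
    have "norm (f (n + 2 * Suc j)) \<le> legendre_coeff_U n n * s * (M / \<rho> ^ (n + 2 * Suc j))"
      unfolding f_def norm_mult norm_of_real s_def
      using legendre_coeff_E_bound[of n j] \<sigma> by (intro mult_mono M) (auto simp: add.commute)
    also have "\<rho> ^ (n + 2 * Suc j) = \<rho> ^ n * (\<rho>\<^sup>2) ^ Suc j"
      by (simp only: power_add power_mult)
    also have "legendre_coeff_U n n * s * (M / (\<rho> ^ n * (\<rho>\<^sup>2) ^ Suc j)) = C * s * (1 / \<rho>\<^sup>2) ^ Suc j"
      by (simp add: C_def power_one_over divide_inverse mult_ac power_inverse del: power_Suc)
    finally show ?thesis .
  qed
  have "f sums legendre_coeff u n"
    unfolding f_def using u M by (rule legendre_coeff_sums)
  moreover have "strict_mono (\<lambda>j. n + 2 * j)" by (auto simp: strict_mono_def)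
  \<comment> \<open>Only the indices \<open>n + 2 j\<close> contribute. The term
    \<open>j = 0\<close> is bounded by \<open>C\<close> and yields the summand 1 of the bound; it is
    split off next.\<close>
  ultimately have "(\<lambda>j. f (n + 2 * j)) sums legendre_coeff u n"
    by (subst sums_mono_reindex) (auto simp: f_def intro!: legendre_coeff_E_eq_0 n)
  then have f: "(\<lambda>j. f (n + 2 * Suc j)) sums (legendre_coeff u n - f n)"
    using sums_Suc_iff[of "\<lambda>j. f (n + 2 * j)" "legendre_coeff u n - f n"] by simp
  have "1 / \<rho>\<^sup>2 < 1" using rho by simp
  then have "(\<lambda>j. C * s * (1 / \<rho>\<^sup>2 * (1 / \<rho>\<^sup>2) ^ j)) sums (C * s * (1 / \<rho>\<^sup>2 * (1 / (1 - 1 / \<rho>\<^sup>2))))"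
    by (intro sums_mult geometric_sums) simp
  \<comment> \<open>The tail starts at \<open>j = 1\<close>, so its geometric sum is
    \<open>1 / (\<rho>^2 - 1)\<close>.\<close>
  moreover have "1 / \<rho>\<^sup>2 * (1 / (1 - 1 / \<rho>\<^sup>2)) = 1 / (\<rho>\<^sup>2 - 1)"
    using rho by (simp add: divide_simps)
  ultimately have g: "(\<lambda>j. C * s * (1 / \<rho>\<^sup>2) ^ Suc j) sums (C * s * (1 / (\<rho>\<^sup>2 - 1)))"
    by simp
  have "norm (legendre_coeff u n - f n) \<le> C * s * (1 / (\<rho>\<^sup>2 - 1))"
    using f g fj by (rule norm_sums_le)
  then have "norm (legendre_coeff u n) \<le> C + C * s * (1 / (\<rho>\<^sup>2 - 1))"
    using fn norm_triangle_sub[of "legendre_coeff u n" "f n"] by linarith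
  then show ?thesis
    unfolding C_def[symmetric] s_def[symmetric] by (simp add: distrib_left mult.assoc)
qed

end

theorem theorem2p2:
  fixes \<rho> M :: real and u :: "complex \<Rightarrow> complex" and n :: nat
  assumes "\<rho> > 1"
    and "u \<in> bernstein_analytic \<rho>"
    and "M = (SUP z\<in>bernstein_ellipse \<rho>. norm (u z))"
    and "n \<ge> 1"
  shows "norm (legendre_coeff u n)
    \<le> M * sqrt (pi * real n) / \<rho> ^ n
      * (1 + (real n + 2) / (2 * real n + 3) * (1 / (\<rho>\<^sup>2 - 1)))
      * exp ((8 * real n - 1) / (12 * real n * (2 * real n - 1)))"
proof -
  interpret bernstein \<rho> using assms(1) by unfold_locales
  define e where "e = exp ((8 * real n - 1) / (12 * real n * (2 * real n - 1)))"
  define c where "c = 1 + (real n + 2) / (2 * real n + 3) * (1 / (\<rho>\<^sup>2 - 1))"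
  obtain z where z: "z \<in> bernstein_ellipse \<rho>" "norm (u z) = M"
      and le: "\<And>z'. z' \<in> bernstein_ellipse \<rho> \<Longrightarrow> norm (u z') \<le> M"
    using SUP_bernstein_ellipse_attained[OF assms(1,2)] unfolding assms(3) by metis
  have M0: "M \<ge> 0" using z by (metis norm_ge_zero)
  have "u analytic_on bernstein_ellipse \<rho>"
    using assms(2) by (auto simp: bernstein_analytic_def intro: analytic_on_subset)
  then have "continuous_on (bernstein_ellipse \<rho>) u"
    by (intro holomorphic_on_imp_continuous_on analytic_imp_holomorphic)
  then have "norm (legendre_coeff u n) \<le> M * legendre_coeff_U n n / \<rho> ^ n * c"
    unfolding c_def using assms(2,4) le by (intro legendre_coeff_bound cheb_coeff_bound)
  \<comment> \<open>The Wallis estimate replaces the leading coefficient; the other factors are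
    nonnegative, \<open>M\<close> being an attained modulus and \<rho> exceeding 1.\<close>
  also have "\<dots> \<le> M * (sqrt (pi * real n) * e) / \<rho> ^ n * c"
    unfolding e_def using assms(1,4) M0
    by (intro mult_right_mono divide_right_mono mult_left_mono legendre_coeff_U_diag_le_exp)
       (auto simp: c_def intro!: add_nonneg_nonneg mult_nonneg_nonneg)
  finally show ?thesis by (simp add: e_def c_def mult_ac)
qed

end
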